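(* Let $(G_j,\tau_j)_{j\in J}$ be a family of topological $T_1$ fan loops, where $J$ is a set. Then the direct product $G=\prod_{j\in J}G_j$, with the Tychonoff product topology $\tau$, is a topological $T_1$ fan loop, and $Z(G)=\prod_{j\in J}Z(G_j)$ and $N(G)=\prod_{j\in J}N(G_j)$.
   Context: A loop is a set $G$ with a binary multiplication such that for all $a,b\in G$ there is a unique $x$ with $ax=b$ (written $x=a\backslash b$) and a unique $y$ with $ya=b$ (written $y=b/a$), and there is $e\in G$ with $eg=ge=g$ for all $g$. The nucleus is $N(G)=\{a\in G:\ (ab)c=a(bc),\ (ba)c=b(ac),\ (bc)a=b(ca)\ \text{for all } b,c\in G\}$; it is a group. The center is $Z(G)=\{a\in N(G): ab=ba\text{ for all } b\in G\}$. A fan loop is a loop such that for all $a,b,c\in G$ there are $t(a,b,c),p(a,b,c)\in N(G)$ with $(ab)c=t(a,b,c)\,(a(bc))$ and $(ab)c=(a(bc))\,p(a,b,c)$. A topological fan loop is a fan loop with a topology for which multiplication, $(a,b)\mapsto a\backslash b$ and $(a,b)\mapsto b/a$ are jointly continuous. The direct product carries the componentwise multiplication. *)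

theory Defs
  imports "HOL-Algebra.Product_Groups" "HOL-Analysis.Analysis"
begin

(* A binary structure with a distinguished neutral element is a HOL-Algebra "monoid" record; nothing
   in that record type asserts associativity.  In a loop the neutral element is unique, so carrying
   it in the record adds no structure.  "product_group", despite its name, is just the componentwise
   multiplication on the extensional functions (PiE) and applies to any such record. *)

locale loop =
  fixes G (structure)
  assumes mult_closed: "\<lbrakk>a \<in> carrier G; b \<in> carrier G\<rbrakk> \<Longrightarrow> a \<otimes> b \<in> carrier G"
    and one_closed: "\<one> \<in> carrier G"
    and l_one: "g \<in> carrier G \<Longrightarrow> \<one> \<otimes> g = g"
    and r_one: "g \<in> carrier G \<Longrightarrow> g \<otimes> \<one> = g"
    and ex1_left_div: "\<lbrakk>a \<in> carrier G; b \<in> carrier G\<rbrakk> \<Longrightarrow> \<exists>!x. x \<in> carrier G \<and> a \<otimes> x = b"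
    and ex1_right_div: "\<lbrakk>a \<in> carrier G; b \<in> carrier G\<rbrakk> \<Longrightarrow> \<exists>!y. y \<in> carrier G \<and> y \<otimes> a = b"

(* left_div G a b is a \ b, and right_div G b a is b / a. *)

definition left_div :: "('a, 'm) monoid_scheme \<Rightarrow> 'a \<Rightarrow> 'a \<Rightarrow> 'a"
  where "left_div G a b = (THE x. x \<in> carrier G \<and> a \<otimes>\<^bsub>G\<^esub> x = b)"

definition right_div :: "('a, 'm) monoid_scheme \<Rightarrow> 'a \<Rightarrow> 'a \<Rightarrow> 'a"
  where "right_div G b a = (THE y. y \<in> carrier G \<and> y \<otimes>\<^bsub>G\<^esub> a = b)"

definition nucleus :: "('a, 'm) monoid_scheme \<Rightarrow> 'a set"
  where "nucleus G =
    {a \<in> carrier G. \<forall>b \<in> carrier G. \<forall>c \<in> carrier G.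
        (a \<otimes>\<^bsub>G\<^esub> b) \<otimes>\<^bsub>G\<^esub> c = a \<otimes>\<^bsub>G\<^esub> (b \<otimes>\<^bsub>G\<^esub> c) \<and>
        (b \<otimes>\<^bsub>G\<^esub> a) \<otimes>\<^bsub>G\<^esub> c = b \<otimes>\<^bsub>G\<^esub> (a \<otimes>\<^bsub>G\<^esub> c) \<and>
        (b \<otimes>\<^bsub>G\<^esub> c) \<otimes>\<^bsub>G\<^esub> a = b \<otimes>\<^bsub>G\<^esub> (c \<otimes>\<^bsub>G\<^esub> a)}"

definition loop_center :: "('a, 'm) monoid_scheme \<Rightarrow> 'a set"
  where "loop_center G = {a \<in> nucleus G. \<forall>b \<in> carrier G. a \<otimes>\<^bsub>G\<^esub> b = b \<otimes>\<^bsub>G\<^esub> a}"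

locale fan_loop = loop +
  assumes ex_t: "\<lbrakk>a \<in> carrier G; b \<in> carrier G; c \<in> carrier G\<rbrakk> \<Longrightarrow>
      \<exists>t \<in> nucleus G. (a \<otimes> b) \<otimes> c = t \<otimes> (a \<otimes> (b \<otimes> c))"
    and ex_p: "\<lbrakk>a \<in> carrier G; b \<in> carrier G; c \<in> carrier G\<rbrakk> \<Longrightarrow>
      \<exists>p \<in> nucleus G. (a \<otimes> b) \<otimes> c = (a \<otimes> (b \<otimes> c)) \<otimes> p"

locale topological_fan_loop = fan_loop G
  for G :: "('a, 'm) monoid_scheme" (structure) and T :: "'a topology" +
  assumes topspace_eq: "topspace T = carrier G"
    and continuous_mult: "continuous_map (prod_topology T T) T (\<lambda>(a, b). a \<otimes> b)"
    and continuous_left_div: "continuous_map (prod_topology T T) T (\<lambda>(a, b). left_div G a b)"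
    and continuous_right_div: "continuous_map (prod_topology T T) T (\<lambda>(a, b). right_div G b a)"

end

theory Submission
  imports Defs
begin

text \<open>
  Every notion in the statement is a componentwise one. Identities pass from the factors to the
  product because an element of the product is determined by its coordinates, and the
  unique solutions in the factors, and chosen witnesses in the factors, assemble to solutions and
  witnesses in the product. In the
  opposite direction, a coordinate \<open>b\<close> in one factor extends to an element of the product,
  since every factor contains a neutral element; hence an identity that holds for all elements of
  the product also holds in each factor. This gives the descriptions of the nucleus and the center
  (lemmas \<open>nucleus_product\<close> and \<open>loop_center_product\<close>), and the first of
  these makes it possible to assemble the elements \<open>t(a,b,c)\<close> and \<open>p(a,b,c)\<close>
  into nucleus elements of the product. The two divisions of the product are the componentwise
  ones, so each of the three operations is continuous by the universal property of the product
  topology (lemma \<open>continuous_map_componentwise_binary\<close>). The separation axiom passes to the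
  product because a singleton of the product is a box of closed singletons.
\<close>

lemma loop_left_div_unique:
  assumes "loop G" "a \<in> carrier G" "b \<in> carrier G" "x \<in> carrier G" "a \<otimes>\<^bsub>G\<^esub> x = b"
  shows "left_div G a b = x"
  unfolding left_div_def
  using assms loop.ex1_left_div[OF assms(1-3)] by (intro the1_equality) auto

lemma loop_right_div_unique:
  assumes "loop G" "a \<in> carrier G" "b \<in> carrier G" "y \<in> carrier G" "y \<otimes>\<^bsub>G\<^esub> a = b"
  shows "right_div G b a = y"
  unfolding right_div_def
  using assms loop.ex1_right_div[OF assms(1-3)] by (intro the1_equality) auto

lemma loop_left_div:
  assumes "loop G" "a \<in> carrier G" "b \<in> carrier G"
  shows "left_div G a b \<in> carrier G" "a \<otimes>\<^bsub>G\<^esub> left_div G a b = b"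
  using theI'[OF loop.ex1_left_div[OF assms]] by (simp_all add: left_div_def)

lemma loop_right_div:
  assumes "loop G" "a \<in> carrier G" "b \<in> carrier G"
  shows "right_div G b a \<in> carrier G" "right_div G b a \<otimes>\<^bsub>G\<^esub> a = b"
  using theI'[OF loop.ex1_right_div[OF assms]] by (simp_all add: right_div_def)

lemma loop_product:
  assumes L: "\<And>j. j \<in> J \<Longrightarrow> loop (G j)"
  shows "loop (product_group J G)"
proof
  fix a b
  assume ab: "a \<in> carrier (product_group J G)" "b \<in> carrier (product_group J G)"
  then show "a \<otimes>\<^bsub>product_group J G\<^esub> b \<in> carrier (product_group J G)"
    by (auto simp: PiE_iff intro!: loop.mult_closed[OF L])
  show "\<exists>!x. x \<in> carrier (product_group J G) \<and> a \<otimes>\<^bsub>product_group J G\<^esub> x = b"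
  proof (rule ex1I)
    show "(\<lambda>j\<in>J. left_div (G j) (a j) (b j)) \<in> carrier (product_group J G) \<and>
        a \<otimes>\<^bsub>product_group J G\<^esub> (\<lambda>j\<in>J. left_div (G j) (a j) (b j)) = b"
      using ab by (auto simp: PiE_iff loop_left_div[OF L] intro!: extensionalityI[of _ J])
  next
    fix x assume "x \<in> carrier (product_group J G) \<and> a \<otimes>\<^bsub>product_group J G\<^esub> x = b"
    then show "x = (\<lambda>j\<in>J. left_div (G j) (a j) (b j))"
      using ab by (auto simp: PiE_iff intro!: extensionalityI[of _ J] loop_left_div_unique[OF L, symmetric])
  qed
  show "\<exists>!y. y \<in> carrier (product_group J G) \<and> y \<otimes>\<^bsub>product_group J G\<^esub> a = b"
  proof (rule ex1I)
    show "(\<lambda>j\<in>J. right_div (G j) (b j) (a j)) \<in> carrier (product_group J G) \<and>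
        (\<lambda>j\<in>J. right_div (G j) (b j) (a j)) \<otimes>\<^bsub>product_group J G\<^esub> a = b"
      using ab by (auto simp: PiE_iff loop_right_div[OF L] intro!: extensionalityI[of _ J])
  next
    fix y assume "y \<in> carrier (product_group J G) \<and> y \<otimes>\<^bsub>product_group J G\<^esub> a = b"
    then show "y = (\<lambda>j\<in>J. right_div (G j) (b j) (a j))"
      using ab by (auto simp: PiE_iff intro!: extensionalityI[of _ J] loop_right_div_unique[OF L, symmetric])
  qed
next
  show "\<one>\<^bsub>product_group J G\<^esub> \<in> carrier (product_group J G)"
    by (auto intro: loop.one_closed[OF L])
next
  fix g assume g: "g \<in> carrier (product_group J G)"
  then show "\<one>\<^bsub>product_group J G\<^esub> \<otimes>\<^bsub>product_group J G\<^esub> g = g"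
    by (auto simp: PiE_iff loop.l_one[OF L] intro!: extensionalityI[of _ J])
  show "g \<otimes>\<^bsub>product_group J G\<^esub> \<one>\<^bsub>product_group J G\<^esub> = g"
    using g by (auto simp: PiE_iff loop.r_one[OF L] intro!: extensionalityI[of _ J])
qed

lemma left_div_product:
  assumes L: "\<And>j. j \<in> J \<Longrightarrow> loop (G j)"
    and ab: "a \<in> carrier (product_group J G)" "b \<in> carrier (product_group J G)"
  shows "left_div (product_group J G) a b = (\<lambda>j\<in>J. left_div (G j) (a j) (b j))"
  using ab
  by (intro loop_left_div_unique loop_product L)
     (auto simp: PiE_iff loop_left_div[OF L] intro!: extensionalityI[of _ J])

lemma right_div_product:
  assumes L: "\<And>j. j \<in> J \<Longrightarrow> loop (G j)"
    and ab: "a \<in> carrier (product_group J G)" "b \<in> carrier (product_group J G)"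
  shows "right_div (product_group J G) b a = (\<lambda>j\<in>J. right_div (G j) (b j) (a j))"
  using ab
  by (intro loop_right_div_unique loop_product L)
     (auto simp: PiE_iff loop_right_div[OF L] intro!: extensionalityI[of _ J])

text \<open>Coordinate projections of the product are onto: fill up the other coordinates with neutral
  elements. This is what transfers identities from the product to its factors.\<close>

lemma product_coordinate_surj:
  assumes L: "\<And>j. j \<in> J \<Longrightarrow> loop (G j)" and "j \<in> J" "b \<in> carrier (G j)"
  obtains b' where "b' \<in> carrier (product_group J G)" "b' j = b"
proof
  show "(\<lambda>k\<in>J. if k = j then b else \<one>\<^bsub>G k\<^esub>) \<in> carrier (product_group J G)"
    using assms by (auto intro: loop.one_closed[OF L])
qed (use \<open>j \<in> J\<close> in simp)

lemma nucleus_product: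
  assumes L: "\<And>j. j \<in> J \<Longrightarrow> loop (G j)"
  shows "nucleus (product_group J G) = (\<Pi>\<^sub>E j\<in>J. nucleus (G j))"
proof (intro equalityI subsetI)
  fix a assume a: "a \<in> nucleus (product_group J G)"
  then have ac: "a \<in> (\<Pi>\<^sub>E j\<in>J. carrier (G j))"
    by (simp add: nucleus_def)
  have "a j \<in> nucleus (G j)" if j: "j \<in> J" for j
    unfolding nucleus_def
  proof (intro CollectI conjI ballI)
    show "a j \<in> carrier (G j)"
      using ac j by auto
    fix b c assume "b \<in> carrier (G j)" "c \<in> carrier (G j)"
    then obtain b' c' where "b' \<in> carrier (product_group J G)" "c' \<in> carrier (product_group J G)"
      and bc: "b' j = b" "c' j = c"
      using product_coordinate_surj[of J G, OF L j] by metis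
    then have id: "a \<otimes>\<^bsub>product_group J G\<^esub> b' \<otimes>\<^bsub>product_group J G\<^esub> c' =
          a \<otimes>\<^bsub>product_group J G\<^esub> (b' \<otimes>\<^bsub>product_group J G\<^esub> c')"
        "b' \<otimes>\<^bsub>product_group J G\<^esub> a \<otimes>\<^bsub>product_group J G\<^esub> c' =
          b' \<otimes>\<^bsub>product_group J G\<^esub> (a \<otimes>\<^bsub>product_group J G\<^esub> c')"
        "b' \<otimes>\<^bsub>product_group J G\<^esub> c' \<otimes>\<^bsub>product_group J G\<^esub> a =
          b' \<otimes>\<^bsub>product_group J G\<^esub> (c' \<otimes>\<^bsub>product_group J G\<^esub> a)"
      using a unfolding nucleus_def by blast+
    show "a j \<otimes>\<^bsub>G j\<^esub> b \<otimes>\<^bsub>G j\<^esub> c = a j \<otimes>\<^bsub>G j\<^esub> (b \<otimes>\<^bsub>G j\<^esub> c)"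
      using fun_cong[OF id(1), of j] j bc by simp
    show "b \<otimes>\<^bsub>G j\<^esub> a j \<otimes>\<^bsub>G j\<^esub> c = b \<otimes>\<^bsub>G j\<^esub> (a j \<otimes>\<^bsub>G j\<^esub> c)"
      using fun_cong[OF id(2), of j] j bc by simp
    show "b \<otimes>\<^bsub>G j\<^esub> c \<otimes>\<^bsub>G j\<^esub> a j = b \<otimes>\<^bsub>G j\<^esub> (c \<otimes>\<^bsub>G j\<^esub> a j)"
      using fun_cong[OF id(3), of j] j bc by simp
  qed
  then show "a \<in> (\<Pi>\<^sub>E j\<in>J. nucleus (G j))"
    using ac by (auto simp: PiE_iff)
next
  fix a assume "a \<in> (\<Pi>\<^sub>E j\<in>J. nucleus (G j))"
  then show "a \<in> nucleus (product_group J G)"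
    by (auto simp: nucleus_def PiE_iff intro!: restrict_ext)
qed

lemma loop_center_product:
  assumes L: "\<And>j. j \<in> J \<Longrightarrow> loop (G j)"
  shows "loop_center (product_group J G) = (\<Pi>\<^sub>E j\<in>J. loop_center (G j))"
proof (intro equalityI subsetI)
  fix a assume a: "a \<in> loop_center (product_group J G)"
  then have an: "a \<in> (\<Pi>\<^sub>E j\<in>J. nucleus (G j))"
    by (simp add: loop_center_def nucleus_product[OF L])
  have "a j \<in> loop_center (G j)" if j: "j \<in> J" for j
    unfolding loop_center_def
  proof (intro CollectI conjI ballI)
    show "a j \<in> nucleus (G j)"
      using an j by auto
    fix b assume "b \<in> carrier (G j)"
    then obtain b' where "b' \<in> carrier (product_group J G)" and b: "b' j = b"
      using product_coordinate_surj[of J G, OF L j] by metis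
    then have "a \<otimes>\<^bsub>product_group J G\<^esub> b' = b' \<otimes>\<^bsub>product_group J G\<^esub> a"
      using a unfolding loop_center_def by blast
    from fun_cong[OF this, of j] show "a j \<otimes>\<^bsub>G j\<^esub> b = b \<otimes>\<^bsub>G j\<^esub> a j"
      using j b by simp
  qed
  then show "a \<in> (\<Pi>\<^sub>E j\<in>J. loop_center (G j))"
    using an by (auto simp: PiE_iff)
next
  fix a assume "a \<in> (\<Pi>\<^sub>E j\<in>J. loop_center (G j))"
  then show "a \<in> loop_center (product_group J G)"
    by (auto simp: loop_center_def nucleus_product[OF L] PiE_iff intro!: restrict_ext)
qed

lemma fan_loop_product:
  assumes F: "\<And>j. j \<in> J \<Longrightarrow> fan_loop (G j)"
  shows "fan_loop (product_group J G)"
proof -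
  have L: "loop (G j)" if "j \<in> J" for j
    using F[OF that] by (rule fan_loop.axioms)
  interpret P: loop "product_group J G"
    using L by (rule loop_product)
  show ?thesis
  proof
    fix a b c
    assume abc: "a \<in> carrier (product_group J G)" "b \<in> carrier (product_group J G)"
      "c \<in> carrier (product_group J G)"
    have "\<forall>j\<in>J. \<exists>t. t \<in> nucleus (G j) \<and> a j \<otimes>\<^bsub>G j\<^esub> b j \<otimes>\<^bsub>G j\<^esub> c j =
        t \<otimes>\<^bsub>G j\<^esub> (a j \<otimes>\<^bsub>G j\<^esub> (b j \<otimes>\<^bsub>G j\<^esub> c j))"
      using abc fan_loop.ex_t[OF F] by (fastforce simp: PiE_iff)
    then obtain t where "\<forall>j\<in>J. t j \<in> nucleus (G j) \<and> a j \<otimes>\<^bsub>G j\<^esub> b j \<otimes>\<^bsub>G j\<^esub> c j =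
        t j \<otimes>\<^bsub>G j\<^esub> (a j \<otimes>\<^bsub>G j\<^esub> (b j \<otimes>\<^bsub>G j\<^esub> c j))"
      by metis
    then show "\<exists>t\<in>nucleus (product_group J G).
        a \<otimes>\<^bsub>product_group J G\<^esub> b \<otimes>\<^bsub>product_group J G\<^esub> c =
        t \<otimes>\<^bsub>product_group J G\<^esub> (a \<otimes>\<^bsub>product_group J G\<^esub> (b \<otimes>\<^bsub>product_group J G\<^esub> c))"
      by (intro bexI[of _ "restrict t J"])
         (auto simp: nucleus_product[OF L] intro!: restrict_ext)
    have "\<forall>j\<in>J. \<exists>p. p \<in> nucleus (G j) \<and> a j \<otimes>\<^bsub>G j\<^esub> b j \<otimes>\<^bsub>G j\<^esub> c j =
        a j \<otimes>\<^bsub>G j\<^esub> (b j \<otimes>\<^bsub>G j\<^esub> c j) \<otimes>\<^bsub>G j\<^esub> p"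
      using abc fan_loop.ex_p[OF F] by (fastforce simp: PiE_iff)
    then obtain p where "\<forall>j\<in>J. p j \<in> nucleus (G j) \<and> a j \<otimes>\<^bsub>G j\<^esub> b j \<otimes>\<^bsub>G j\<^esub> c j =
        a j \<otimes>\<^bsub>G j\<^esub> (b j \<otimes>\<^bsub>G j\<^esub> c j) \<otimes>\<^bsub>G j\<^esub> p j"
      by metis
    then show "\<exists>p\<in>nucleus (product_group J G).
        a \<otimes>\<^bsub>product_group J G\<^esub> b \<otimes>\<^bsub>product_group J G\<^esub> c =
        a \<otimes>\<^bsub>product_group J G\<^esub> (b \<otimes>\<^bsub>product_group J G\<^esub> c) \<otimes>\<^bsub>product_group J G\<^esub> p"
      by (intro bexI[of _ "restrict p J"])
         (auto simp: nucleus_product[OF L] intro!: restrict_ext)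
  qed
qed

text \<open>By the universal property of the product topology it suffices that each coordinate of the
  operation is continuous, and the coordinate at \<open>j\<close> factors through the pair of
  projections to \<open>T j\<close>.\<close>

lemma continuous_map_componentwise_binary:
  assumes f: "\<And>j. j \<in> J \<Longrightarrow> continuous_map (prod_topology (T j) (T j)) (U j) (\<lambda>(a, b). f j a b)"
  shows "continuous_map (prod_topology (product_topology T J) (product_topology T J))
    (product_topology U J) (\<lambda>(a, b). \<lambda>j\<in>J. f j (a j) (b j))"
proof -
  have "continuous_map (prod_topology (product_topology T J) (product_topology T J)) (U j)
      (\<lambda>x. f j (fst x j) (snd x j))" if j: "j \<in> J" for j
  proof -
    let ?P = "prod_topology (product_topology T J) (product_topology T J)"
    have "continuous_map ?P (T j) (\<lambda>x. fst x j)" "continuous_map ?P (T j) (\<lambda>x. snd x j)"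
      using continuous_map_compose[OF continuous_map_fst continuous_map_product_projection[OF j]]
        continuous_map_compose[OF continuous_map_snd continuous_map_product_projection[OF j]]
      by (simp_all add: o_def)
    then have "continuous_map ?P (prod_topology (T j) (T j)) (\<lambda>x. (fst x j, snd x j))"
      by (simp add: continuous_map_pairedI)
    from continuous_map_compose[OF this f[OF j]] show ?thesis
      by (simp add: o_def)
  qed
  then show ?thesis
    by (auto simp: continuous_map_componentwise case_prod_unfold)
qed

theorem theorem4p1:
  fixes J :: "'j set"
    and G :: "'j \<Rightarrow> ('a, 'm) monoid_scheme"
    and T :: "'j \<Rightarrow> 'a topology"
  assumes "\<And>j. j \<in> J \<Longrightarrow> topological_fan_loop (G j) (T j)"
    and "\<And>j. j \<in> J \<Longrightarrow> t1_space (T j)"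
  shows "topological_fan_loop (product_group J G) (product_topology T J)
    \<and> t1_space (product_topology T J)
    \<and> loop_center (product_group J G) = (\<Pi>\<^sub>E j\<in>J. loop_center (G j))
    \<and> nucleus (product_group J G) = (\<Pi>\<^sub>E j\<in>J. nucleus (G j))"
proof (intro conjI)
  have F: "fan_loop (G j)" if "j \<in> J" for j
    using assms(1)[OF that] by (rule topological_fan_loop.axioms)
  then have L: "loop (G j)" if "j \<in> J" for j
    using that fan_loop.axioms(1) by blast
  interpret P: fan_loop "product_group J G"
    using F by (rule fan_loop_product)
  let ?PT = "prod_topology (product_topology T J) (product_topology T J)"
  have top: "topspace (product_topology T J) = carrier (product_group J G)"
    using topological_fan_loop.topspace_eq[OF assms(1)] by (auto simp: PiE_iff)
  show "topological_fan_loop (product_group J G) (product_topology T J)"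
  proof
    show "topspace (product_topology T J) = carrier (product_group J G)"
      by (rule top)
    show "continuous_map ?PT (product_topology T J) (\<lambda>(a, b). a \<otimes>\<^bsub>product_group J G\<^esub> b)"
      using continuous_map_componentwise_binary[OF topological_fan_loop.continuous_mult[OF assms(1)]]
      by simp
    \<comment> \<open>The divisions of the product are known to be componentwise on its carrier only, which is
      the whole space.\<close>
    show "continuous_map ?PT (product_topology T J) (\<lambda>(a, b). left_div (product_group J G) a b)"
      by (rule continuous_map_eq[OF continuous_map_componentwise_binary
            [OF topological_fan_loop.continuous_left_div[OF assms(1)]]])
         (auto simp: top left_div_product[OF L] simp del: topspace_product_topology carrier_product_group)
    show "continuous_map ?PT (product_topology T J) (\<lambda>(a, b). right_div (product_group J G) b a)"
      by (rule continuous_map_eq[OF continuous_map_componentwise_binary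
            [OF topological_fan_loop.continuous_right_div[OF assms(1)]]])
         (auto simp: top right_div_product[OF L] simp del: topspace_product_topology carrier_product_group)
  qed
  show "t1_space (product_topology T J)"
    using assms(2) by (simp add: t1_space_product_topology)
  show "loop_center (product_group J G) = (\<Pi>\<^sub>E j\<in>J. loop_center (G j))"
    using L by (rule loop_center_product)
  show "nucleus (product_group J G) = (\<Pi>\<^sub>E j\<in>J. nucleus (G j))"
    using L by (rule nucleus_product)
qed

end
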